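(* Let $\lambda$ be an infinite cardinal and let $\mathscr{I}^{\mathrm{cf}}_\lambda$ be the monoid of injective partial cofinite selfmaps of $\lambda$. Then: (i) $\mathscr{I}^{\mathrm{cf}}_\lambda$ is a simple semigroup. (ii) An element $\alpha$ of $\mathscr{I}^{\mathrm{cf}}_\lambda$ is an idempotent if and only if $(x)\alpha=x$ for every $x\in\operatorname{dom}\alpha$. (iii) If $\varepsilon,\iota\in E(\mathscr{I}^{\mathrm{cf}}_\lambda)$, then $\varepsilon\leqslant\iota$ if and only if $\operatorname{dom}\varepsilon\subseteq\operatorname{dom}\iota$. (iv) The semilattice $E(\mathscr{I}^{\mathrm{cf}}_\lambda)$ is isomorphic to $(\mathscr{P}_{<\omega}(\lambda),\cup)$ under the mapping $(\varepsilon)h=\lambda\setminus\operatorname{dom}\varepsilon$. (v) Every maximal chain in $E(\mathscr{I}^{\mathrm{cf}}_\lambda)$ is an $\omega$-chain. (vi) For $\alpha,\beta\in\mathscr{I}^{\mathrm{cf}}_\lambda$: $\alpha\mathscr{R}\beta$ in $\mathscr{I}^{\mathrm{cf}}_\lambda$ if and only if $\operatorname{dom}\alpha=\operatorname{dom}\beta$. (vii) For $\alpha,\beta\in\mathscr{I}^{\mathrm{cf}}_\lambda$: $\alpha\mathscr{L}\beta$ in $\mathscr{I}^{\mathrm{cf}}_\lambda$ if and only if $\operatorname{ran}\alpha=\operatorname{ran}\beta$. (viii) For $\alpha,\beta\in\mathscr{I}^{\mathrm{cf}}_\lambda$: $\alpha\mathscr{H}\beta$ in $\mathscr{I}^{\mathrm{cf}}_\lambda$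 if and only if $\operatorname{dom}\alpha=\operatorname{dom}\beta$ and $\operatorname{ran}\alpha=\operatorname{ran}\beta$. (ix) $\alpha\mathscr{D}\beta$ for all $\alpha,\beta\in\mathscr{I}^{\mathrm{cf}}_\lambda$, and hence the semigroup $\mathscr{I}^{\mathrm{cf}}_\lambda$ is bisimple.
   Context: The infinite cardinal $\lambda$ is identified with a set of cardinality $\lambda$. $\mathscr{I}^{\mathrm{cf}}_\lambda$ is the set of all injective partial maps $\alpha\colon\lambda\rightharpoonup\lambda$ such that $\lambda\setminus\operatorname{dom}\alpha$ and $\lambda\setminus\operatorname{ran}\alpha$ are both finite. Maps are written on the right and composed left to right: $x(\alpha\beta)=(x\alpha)\beta$ for $x\in\operatorname{dom}(\alpha\beta)=\{y\in\operatorname{dom}\alpha\mid y\alpha\in\operatorname{dom}\beta\}$. With this operation $\mathscr{I}^{\mathrm{cf}}_\lambda$ is an inverse monoid. For an inverse semigroup $S$, $E(S)$ is the semilattice of idempotents of $S$ with the natural partial order $e\leqslant f$ iff $ef=fe=e$. A chain in $E(S)$ is a linearly ordered subset; a maximal chain is one not properly contained in any other chain. A chain is an $\omega$-chain if it is order isomorphic to $\{0,-1,-2,-3,\ldots\}$ with the usual order. $(\mathscr{P}_{<\omega}(\lambda),\cup)$ is the set of all finite subsets of $\lambda$ (including the empty set) with the operation of union. $\mathscr{R},\mathscr{L},\mathscr{H},\mathscr{D}$ are Green's relations: $a\mathscr{R}b$ iff $a,b$ generate the same principal right ideal, $a\mathscr{L}b$ iff they generate the same principal left ideal, $\mathscr{H}=\mathscr{R}\cap\mathscr{L}$,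 $\mathscr{D}=\mathscr{R}\circ\mathscr{L}$. A semigroup is simple if it has no proper two-sided ideals, and bisimple if it has only one $\mathscr{D}$-class. *)

theory Defs
  imports "HOL-Algebra.Group"
begin

text \<open>
  Semigroups are represented by the \<^typ>\<open>('a, 'b) monoid_scheme\<close> records of HOL-Algebra; the notions
  of this section use only the carrier and the multiplication.
\<close>

subsection \<open>Idempotents and their natural partial order\<close>

definition idempotents :: "('a, 'b) monoid_scheme \<Rightarrow> 'a set" where
  "idempotents S = {e \<in> carrier S. e \<otimes>\<^bsub>S\<^esub> e = e}"

definition idempotent_semilattice :: "('a, 'b) monoid_scheme \<Rightarrow> ('a, 'b) monoid_scheme" where
  "idempotent_semilattice S = S\<lparr>carrier := idempotents S\<rparr>"

definition natural_le :: "('a, 'b) monoid_scheme \<Rightarrow> 'a \<Rightarrow> 'a \<Rightarrow> bool" where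
  "natural_le S e f \<longleftrightarrow> e \<otimes>\<^bsub>S\<^esub> f = e \<and> f \<otimes>\<^bsub>S\<^esub> e = e"

text \<open>
  \<^const>\<open>pred_on.maxchain\<close> is Zorn's notion of a maximal chain of a set with respect to a
  relation; it passes to the reflexive closure of the relation, which changes nothing here since
  \<^const>\<open>natural_le\<close> is reflexive on idempotents.
\<close>

definition maximal_idempotent_chain :: "('a, 'b) monoid_scheme \<Rightarrow> 'a set \<Rightarrow> bool" where
  "maximal_idempotent_chain S C \<longleftrightarrow> pred_on.maxchain (idempotents S) (natural_le S) C"

definition omega_chain :: "('a \<Rightarrow> 'a \<Rightarrow> bool) \<Rightarrow> 'a set \<Rightarrow> bool" where
  "omega_chain r C \<longleftrightarrow>
     (\<exists>\<phi>. bij_betw \<phi> C {..0::int} \<and> (\<forall>x\<in>C. \<forall>y\<in>C. r x y \<longleftrightarrow> \<phi> x \<le> \<phi> y))"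

subsection \<open>Ideals and Green's relations\<close>

definition two_sided_ideal :: "('a, 'b) monoid_scheme \<Rightarrow> 'a set \<Rightarrow> bool" where
  "two_sided_ideal S I \<longleftrightarrow> I \<subseteq> carrier S \<and> I \<noteq> {} \<and>
     (\<forall>a\<in>I. \<forall>s\<in>carrier S. s \<otimes>\<^bsub>S\<^esub> a \<in> I \<and> a \<otimes>\<^bsub>S\<^esub> s \<in> I)"

definition simple_semigroup :: "('a, 'b) monoid_scheme \<Rightarrow> bool" where
  "simple_semigroup S \<longleftrightarrow> (\<forall>I. two_sided_ideal S I \<longrightarrow> I = carrier S)"

definition principal_right_ideal :: "('a, 'b) monoid_scheme \<Rightarrow> 'a \<Rightarrow> 'a set" where
  "principal_right_ideal S a = insert a {a \<otimes>\<^bsub>S\<^esub> s | s. s \<in> carrier S}"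

definition principal_left_ideal :: "('a, 'b) monoid_scheme \<Rightarrow> 'a \<Rightarrow> 'a set" where
  "principal_left_ideal S a = insert a {s \<otimes>\<^bsub>S\<^esub> a | s. s \<in> carrier S}"

definition green_R :: "('a, 'b) monoid_scheme \<Rightarrow> 'a rel" where
  "green_R S = {(a, b). a \<in> carrier S \<and> b \<in> carrier S \<and>
     principal_right_ideal S a = principal_right_ideal S b}"

definition green_L :: "('a, 'b) monoid_scheme \<Rightarrow> 'a rel" where
  "green_L S = {(a, b). a \<in> carrier S \<and> b \<in> carrier S \<and>
     principal_left_ideal S a = principal_left_ideal S b}"

definition green_H :: "('a, 'b) monoid_scheme \<Rightarrow> 'a rel" where
  "green_H S = green_R S \<inter> green_L S"

definition green_D :: "('a, 'b) monoid_scheme \<Rightarrow> 'a rel" where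
  "green_D S = green_R S O green_L S"

definition bisimple_semigroup :: "('a, 'b) monoid_scheme \<Rightarrow> bool" where
  "bisimple_semigroup S \<longleftrightarrow> is_singleton (carrier S // green_D S)"

subsection \<open>Injective partial cofinite selfmaps\<close>

text \<open>
  The cardinal is represented by an arbitrary set \<open>\<Lambda>\<close> of that cardinality. Maps act on the right and
  are composed from left to right, so the product of \<open>\<alpha>\<close> and \<open>\<beta>\<close> is \<open>\<beta> \<circ>\<^sub>m \<alpha>\<close>.
\<close>

definition Icf :: "'a set \<Rightarrow> ('a \<rightharpoonup> 'a) monoid" where
  "Icf \<Lambda> = \<lparr>
     carrier = {\<alpha>. dom \<alpha> \<subseteq> \<Lambda> \<and> ran \<alpha> \<subseteq> \<Lambda> \<and> inj_on \<alpha> (dom \<alpha>) \<and>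
                   finite (\<Lambda> - dom \<alpha>) \<and> finite (\<Lambda> - ran \<alpha>)},
     monoid.mult = (\<lambda>\<alpha> \<beta>. \<beta> \<circ>\<^sub>m \<alpha>),
     one = (\<lambda>x. if x \<in> \<Lambda> then Some x else None)\<rparr>"

definition Pfin :: "'a set \<Rightarrow> 'a set monoid" where
  "Pfin \<Lambda> = \<lparr>carrier = {A. A \<subseteq> \<Lambda> \<and> finite A}, monoid.mult = (\<union>), one = {}\<rparr>"

lemma Icf_mult_closed:
  assumes a: "\<alpha> \<in> carrier (Icf \<Lambda>)" and b: "\<beta> \<in> carrier (Icf \<Lambda>)"
  shows "\<alpha> \<otimes>\<^bsub>Icf \<Lambda>\<^esub> \<beta> \<in> carrier (Icf \<Lambda>)"
proof -
  let ?c = "\<beta> \<circ>\<^sub>m \<alpha>"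
  have ia: "\<And>x y z. \<alpha> x = Some z \<Longrightarrow> \<alpha> y = Some z \<Longrightarrow> x = y"
    using a by (simp add: Icf_def inj_on_def) (metis domI)
  have ib: "\<And>x y z. \<beta> x = Some z \<Longrightarrow> \<beta> y = Some z \<Longrightarrow> x = y"
    using b by (simp add: Icf_def inj_on_def) (metis domI)
  have c: "\<And>x z. ?c x = Some z \<longleftrightarrow> (\<exists>y. \<alpha> x = Some y \<and> \<beta> y = Some z)"
    by (simp add: map_comp_Some_iff)
  have inj: "inj_on ?c (dom ?c)"
  proof (rule inj_onI)
    fix x y assume "x \<in> dom ?c" and eq: "?c x = ?c y"
    then obtain z where "?c x = Some z" by blast
    with eq have "?c x = Some z" "?c y = Some z" by simp_all
    then show "x = y" unfolding c using ia ib by blast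
  qed
  have dsub: "dom ?c \<subseteq> \<Lambda>"
  proof
    fix x assume "x \<in> dom ?c"
    then have "x \<in> dom \<alpha>" using c by blast
    then show "x \<in> \<Lambda>" using a by (auto simp: Icf_def)
  qed
  have rsub: "ran ?c \<subseteq> \<Lambda>"
  proof
    fix z assume "z \<in> ran ?c"
    then obtain x where "?c x = Some z" by (auto simp: ran_def)
    then have "z \<in> ran \<beta>" unfolding c by (auto intro: ranI)
    then show "z \<in> \<Lambda>" using b by (auto simp: Icf_def)
  qed
  have "\<Lambda> - dom ?c \<subseteq> (\<Lambda> - dom \<alpha>) \<union> (\<lambda>y. SOME x. \<alpha> x = Some y) ` (\<Lambda> - dom \<beta>)"
  proof
    fix x assume x: "x \<in> \<Lambda> - dom ?c"
    show "x \<in> (\<Lambda> - dom \<alpha>) \<union> (\<lambda>y. SOME x. \<alpha> x = Some y) ` (\<Lambda> - dom \<beta>)"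
    proof (cases "\<alpha> x")
      case None
      then show ?thesis using x by auto
    next
      case (Some y)
      have "y \<in> \<Lambda>" using Some a by (auto simp: Icf_def ran_def)
      moreover have "y \<notin> dom \<beta>" using x Some c by blast
      moreover have "x = (SOME x. \<alpha> x = Some y)"
        using Some ia by (metis (mono_tags, lifting) someI)
      ultimately show ?thesis by blast
    qed
  qed
  then have fd: "finite (\<Lambda> - dom ?c)"
    using a b by (auto simp: Icf_def intro: finite_subset)
  have "\<Lambda> - ran ?c \<subseteq> (\<Lambda> - ran \<beta>) \<union> (\<lambda>y. the (\<beta> y)) ` (\<Lambda> - ran \<alpha>)"
  proof
    fix z assume z: "z \<in> \<Lambda> - ran ?c"
    show "z \<in> (\<Lambda> - ran \<beta>) \<union> (\<lambda>y. the (\<beta> y)) ` (\<Lambda> - ran \<alpha>)"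
    proof (cases "z \<in> ran \<beta>")
      case True
      then obtain y where y: "\<beta> y = Some z" by (auto simp: ran_def)
      then have "y \<in> \<Lambda>" using b by (auto simp: Icf_def)
      moreover have "y \<notin> ran \<alpha>" using z y c by (auto simp: ran_def)
      moreover have "z = the (\<beta> y)" using y by simp
      ultimately show ?thesis by blast
    qed (use z in auto)
  qed
  then have fr: "finite (\<Lambda> - ran ?c)"
    using a b by (auto simp: Icf_def intro: finite_subset)
  show ?thesis using inj dsub rsub fd fr by (simp add: Icf_def)
qed

lemma Icf_monoid: "monoid (Icf \<Lambda>)"
proof (rule monoidI)
  show "\<one>\<^bsub>Icf \<Lambda>\<^esub> \<in> carrier (Icf \<Lambda>)"
  proof -
    have "dom (\<lambda>x. if x \<in> \<Lambda> then Some x else None) = \<Lambda>"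
      and "ran (\<lambda>x. if x \<in> \<Lambda> then Some x else None) = \<Lambda>"
      by (auto simp: dom_def ran_def split: if_splits)
    then show ?thesis by (auto simp: Icf_def inj_on_def)
  qed
next
  fix \<alpha> assume a: "\<alpha> \<in> carrier (Icf \<Lambda>)"
  show "\<one>\<^bsub>Icf \<Lambda>\<^esub> \<otimes>\<^bsub>Icf \<Lambda>\<^esub> \<alpha> = \<alpha>"
  proof
    fix x
    have "x \<notin> \<Lambda> \<Longrightarrow> \<alpha> x = None" using a by (auto simp: Icf_def)
    then show "(\<one>\<^bsub>Icf \<Lambda>\<^esub> \<otimes>\<^bsub>Icf \<Lambda>\<^esub> \<alpha>) x = \<alpha> x" by (simp add: Icf_def map_comp_def)
  qed
  show "\<alpha> \<otimes>\<^bsub>Icf \<Lambda>\<^esub> \<one>\<^bsub>Icf \<Lambda>\<^esub> = \<alpha>"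
    using a by (auto simp: Icf_def map_comp_def fun_eq_iff ran_def split: option.split)
next
  fix \<alpha> \<beta> \<gamma>
  show "\<alpha> \<otimes>\<^bsub>Icf \<Lambda>\<^esub> \<beta> \<otimes>\<^bsub>Icf \<Lambda>\<^esub> \<gamma> = \<alpha> \<otimes>\<^bsub>Icf \<Lambda>\<^esub> (\<beta> \<otimes>\<^bsub>Icf \<Lambda>\<^esub> \<gamma>)"
    by (auto simp: Icf_def map_comp_def fun_eq_iff split: option.split)
qed (rule Icf_mult_closed)

lemma Icf_idempotent_id:
  assumes e: "\<epsilon> \<in> idempotents (Icf \<Lambda>)" and x: "\<epsilon> x = Some y"
  shows "y = x"
proof -
  have "(\<epsilon> \<circ>\<^sub>m \<epsilon>) x = \<epsilon> x" using e by (simp add: idempotents_def Icf_def)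
  then have "\<epsilon> y = Some y" using x by simp
  then show ?thesis
    using e x by (auto simp: idempotents_def Icf_def inj_on_def dom_def)
qed

lemma Icf_idempotent_comm_monoid: "comm_monoid (idempotent_semilattice (Icf \<Lambda>))"
proof -
  interpret M: monoid "Icf \<Lambda>" by (rule Icf_monoid)
  have commute: "e \<otimes>\<^bsub>Icf \<Lambda>\<^esub> f = f \<otimes>\<^bsub>Icf \<Lambda>\<^esub> e"
    if "e \<in> idempotents (Icf \<Lambda>)" "f \<in> idempotents (Icf \<Lambda>)" for e f
  proof
    fix x
    show "(e \<otimes>\<^bsub>Icf \<Lambda>\<^esub> f) x = (f \<otimes>\<^bsub>Icf \<Lambda>\<^esub> e) x"
      using Icf_idempotent_id[OF that(1), of x] Icf_idempotent_id[OF that(2), of x]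
      by (cases "e x"; cases "f x") (auto simp: Icf_def map_comp_def)
  qed
  have closed: "e \<otimes>\<^bsub>Icf \<Lambda>\<^esub> f \<in> idempotents (Icf \<Lambda>)"
    if "e \<in> idempotents (Icf \<Lambda>)" "f \<in> idempotents (Icf \<Lambda>)" for e f
  proof -
    have c: "e \<in> carrier (Icf \<Lambda>)" "f \<in> carrier (Icf \<Lambda>)"
      and i: "e \<otimes>\<^bsub>Icf \<Lambda>\<^esub> e = e" "f \<otimes>\<^bsub>Icf \<Lambda>\<^esub> f = f"
      using that by (auto simp: idempotents_def)
    have "(e \<otimes>\<^bsub>Icf \<Lambda>\<^esub> f) \<otimes>\<^bsub>Icf \<Lambda>\<^esub> (e \<otimes>\<^bsub>Icf \<Lambda>\<^esub> f) = e \<otimes>\<^bsub>Icf \<Lambda>\<^esub> f"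
      using c i commute[OF that] by (metis M.m_assoc M.m_closed)
    then show ?thesis using c by (simp add: idempotents_def)
  qed
  have sub: "idempotents (Icf \<Lambda>) \<subseteq> carrier (Icf \<Lambda>)" and one: "\<one>\<^bsub>Icf \<Lambda>\<^esub> \<in> idempotents (Icf \<Lambda>)"
    by (auto simp: idempotents_def)
  show ?thesis
  proof (rule comm_monoidI)
    fix x y
    assume "x \<in> carrier (idempotent_semilattice (Icf \<Lambda>))"
      and "y \<in> carrier (idempotent_semilattice (Icf \<Lambda>))"
    then show "x \<otimes>\<^bsub>idempotent_semilattice (Icf \<Lambda>)\<^esub> y = y \<otimes>\<^bsub>idempotent_semilattice (Icf \<Lambda>)\<^esub> x"
      by (simp add: idempotent_semilattice_def commute)
  qed (use sub in \<open>simp_all add: idempotent_semilattice_def closed one M.m_assoc subset_iff\<close>)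
qed

end

theory Submission
  imports Defs "HOL-Library.Equipollence"
begin

text \<open>
  Green's relations and simplicity rest on two facts. First, every \<open>\<alpha>\<close> in the monoid has a converse \<open>\<alpha>'\<close> in the
  monoid, with \<open>\<alpha>\<alpha>'\<close> the identity of \<open>dom \<alpha>\<close> and \<open>\<alpha>'\<alpha>\<close> the identity of \<open>ran \<alpha>\<close>. If \<open>dom \<gamma>\<close> lies in
  \<open>dom \<alpha>\<close>, then \<open>\<gamma> = \<alpha>(\<alpha>'\<gamma>)\<close>; so the principal right ideal of \<open>\<alpha>\<close> consists of all \<open>\<gamma>\<close> with
  \<open>dom \<gamma> \<subseteq> dom \<alpha>\<close>, and dually for left ideals and ranges (\<open>Icf_principal_right_ideal\<close>,
  \<open>Icf_principal_left_ideal\<close>). This gives \<open>\<R>\<close>, \<open>\<L>\<close> and \<open>\<H>\<close>. Second, any two cofinite subsets of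
  an infinite set are in bijection. A bijection from \<open>dom \<alpha>\<close> to \<open>ran \<beta>\<close> is an element of the monoid
  that is \<open>\<R>\<close>-related to \<open>\<alpha>\<close> and \<open>\<L>\<close>-related to \<open>\<beta>\<close>, so there is only one \<open>\<D>\<close>-class. A nonempty
  ideal is a union of \<open>\<D>\<close>-classes, which gives simplicity.

  The idempotents are the identities \<open>Some |` A\<close> of the cofinite subsets \<open>A\<close> of \<open>\<Lambda>\<close>, and so
  correspond to the finite subsets of \<open>\<Lambda>\<close> with inclusion reversed. A maximal chain of finite subsets
  cannot skip a cardinality: some element could be added to the last member before the gap, giving a
  finite set that is still comparable with the whole chain; as \<open>\<Lambda>\<close> is infinite, the chain cannot stop
  either. Hence cardinality maps such a chain bijectively onto the natural numbers
  (\<open>bij_betw_card_maximal_finite_chain\<close>), and the negative of the cardinality of the complement of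
  the domain is an order isomorphism from a maximal chain of idempotents to the integers \<open>\<le> 0\<close>.
\<close>

section \<open>Semigroups with a single \<open>\<D>\<close>-class\<close>

text \<open>
  An ideal that contains \<open>a\<close> contains both principal one-sided ideals of \<open>a\<close>, hence all elements
  \<open>\<R>\<close>-related or \<open>\<L>\<close>-related to \<open>a\<close>; starting from one element, two such steps reach the whole
  semigroup.
\<close>

lemma simple_semigroup_if_one_D_class:
  assumes D: "\<And>a b. a \<in> carrier S \<Longrightarrow> b \<in> carrier S \<Longrightarrow> (a, b) \<in> green_D S"
  shows "simple_semigroup S"
  unfolding simple_semigroup_def
proof (intro allI impI)
  fix I assume I: "two_sided_ideal S I"
  then obtain a where a: "a \<in> I" "a \<in> carrier S"
    by (auto simp: two_sided_ideal_def)
  have right: "c \<in> I" if "(a, c) \<in> green_R S" "a \<in> I" for a c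
  proof -
    have "c \<in> principal_right_ideal S c"
      by (simp add: principal_right_ideal_def)
    then have "c \<in> principal_right_ideal S a"
      using that(1) by (simp add: green_R_def)
    then show ?thesis
      using I that(2) by (auto simp: principal_right_ideal_def two_sided_ideal_def)
  qed
  have left: "c \<in> I" if "(a, c) \<in> green_L S" "a \<in> I" for a c
  proof -
    have "c \<in> principal_left_ideal S c"
      by (simp add: principal_left_ideal_def)
    then have "c \<in> principal_left_ideal S a"
      using that(1) by (simp add: green_L_def)
    then show ?thesis
      using I that(2) by (auto simp: principal_left_ideal_def two_sided_ideal_def)
  qed
  have "carrier S \<subseteq> I"
  proof
    fix b assume "b \<in> carrier S"
    then obtain c where "(a, c) \<in> green_R S" "(c, b) \<in> green_L S"
      using D[OF a(2)] by (auto simp: green_D_def)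
    then show "b \<in> I"
      using a(1) left right by blast
  qed
  then show "I = carrier S"
    using I by (auto simp: two_sided_ideal_def)
qed

lemma bisimple_semigroup_if_one_D_class:
  assumes "carrier S \<noteq> {}"
    and D: "\<And>a b. a \<in> carrier S \<Longrightarrow> b \<in> carrier S \<Longrightarrow> (a, b) \<in> green_D S"
  shows "bisimple_semigroup S"
proof -
  have "green_D S = carrier S \<times> carrier S"
    using D by (auto simp: green_D_def green_R_def green_L_def)
  then have "carrier S // green_D S = {carrier S}"
    using assms(1) by (auto simp: quotient_def)
  then show ?thesis
    by (simp add: bisimple_semigroup_def)
qed

section \<open>Converses and principal ideals\<close>

lemma Icf_mult: "\<alpha> \<otimes>\<^bsub>Icf \<Lambda>\<^esub> \<beta> = \<beta> \<circ>\<^sub>m \<alpha>"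
  by (simp add: Icf_def)

lemma mem_Icf:
  "\<alpha> \<in> carrier (Icf \<Lambda>) \<longleftrightarrow> dom \<alpha> \<subseteq> \<Lambda> \<and> ran \<alpha> \<subseteq> \<Lambda> \<and> inj_on \<alpha> (dom \<alpha>) \<and>
     finite (\<Lambda> - dom \<alpha>) \<and> finite (\<Lambda> - ran \<alpha>)"
  by (simp add: Icf_def)

definition partial_inverse :: "('a \<rightharpoonup> 'b) \<Rightarrow> 'b \<rightharpoonup> 'a" where
  "partial_inverse \<alpha> y = (if y \<in> ran \<alpha> then Some (THE x. \<alpha> x = Some y) else None)"

lemma partial_inverse_eq_Some_iff:
  assumes "inj_on \<alpha> (dom \<alpha>)"
  shows "partial_inverse \<alpha> y = Some x \<longleftrightarrow> \<alpha> x = Some y"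
proof -
  have unique: "\<alpha> u = Some y \<Longrightarrow> \<alpha> v = Some y \<Longrightarrow> u = v" for u v
    using assms by (auto simp: inj_on_def dom_def)
  have the_eq: "(THE u. \<alpha> u = Some y) = v" if "\<alpha> v = Some y" for v
    using that unique by blast
  show ?thesis
    using the_eq by (auto simp: partial_inverse_def ran_def)
qed

lemma dom_partial_inverse: "dom (partial_inverse \<alpha>) = ran \<alpha>"
  by (auto simp: partial_inverse_def split: if_splits)

lemma ran_partial_inverse:
  assumes "inj_on \<alpha> (dom \<alpha>)"
  shows "ran (partial_inverse \<alpha>) = dom \<alpha>"
  by (auto simp: ran_def partial_inverse_eq_Some_iff[OF assms])

lemma partial_inverse_in_Icf:
  assumes \<alpha>: "\<alpha> \<in> carrier (Icf \<Lambda>)"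
  shows "partial_inverse \<alpha> \<in> carrier (Icf \<Lambda>)"
proof -
  have inj: "inj_on \<alpha> (dom \<alpha>)"
    using \<alpha> by (simp add: mem_Icf)
  have "inj_on (partial_inverse \<alpha>) (dom (partial_inverse \<alpha>))"
  proof (rule inj_onI)
    fix y z assume "y \<in> dom (partial_inverse \<alpha>)" "partial_inverse \<alpha> y = partial_inverse \<alpha> z"
    then obtain x where "partial_inverse \<alpha> y = Some x" "partial_inverse \<alpha> z = Some x"
      by (metis domD)
    then show "y = z"
      by (simp add: partial_inverse_eq_Some_iff[OF inj])
  qed
  then show ?thesis
    using \<alpha> by (simp add: mem_Icf dom_partial_inverse ran_partial_inverse)
qed

lemma map_comp_partial_inverse_left:
  assumes inj: "inj_on \<alpha> (dom \<alpha>)" and "dom \<gamma> \<subseteq> dom \<alpha>"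
  shows "(\<gamma> \<circ>\<^sub>m partial_inverse \<alpha>) \<circ>\<^sub>m \<alpha> = \<gamma>"
proof
  fix x
  show "((\<gamma> \<circ>\<^sub>m partial_inverse \<alpha>) \<circ>\<^sub>m \<alpha>) x = \<gamma> x"
  proof (cases "\<alpha> x")
    case None
    then have "\<gamma> x = None"
      using assms(2) by (metis domIff subsetD)
    then show ?thesis
      using None by simp
  next
    case (Some y)
    then have "partial_inverse \<alpha> y = Some x"
      by (simp add: partial_inverse_eq_Some_iff[OF inj])
    then show ?thesis
      using Some by simp
  qed
qed

lemma map_comp_partial_inverse_right:
  assumes inj: "inj_on \<alpha> (dom \<alpha>)" and "ran \<gamma> \<subseteq> ran \<alpha>"
  shows "\<alpha> \<circ>\<^sub>m (partial_inverse \<alpha> \<circ>\<^sub>m \<gamma>) = \<gamma>"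
proof
  fix x
  show "(\<alpha> \<circ>\<^sub>m (partial_inverse \<alpha> \<circ>\<^sub>m \<gamma>)) x = \<gamma> x"
  proof (cases "\<gamma> x")
    case None
    then show ?thesis
      by simp
  next
    case (Some y)
    then have "y \<in> ran \<alpha>"
      using assms(2) by (auto intro: ranI)
    then obtain u where u: "\<alpha> u = Some y"
      by (auto simp: ran_def)
    then have "partial_inverse \<alpha> y = Some u"
      by (simp add: partial_inverse_eq_Some_iff[OF inj])
    then show ?thesis
      using Some u by simp
  qed
qed

text \<open>
  A product \<open>\<alpha>\<sigma>\<close> is defined only where \<open>\<alpha>\<close> is; conversely a \<open>\<gamma>\<close> with \<open>dom \<gamma> \<subseteq> dom \<alpha>\<close> factors
  as \<open>\<alpha>(\<alpha>'\<gamma>)\<close>, where \<open>\<alpha>'\<close> is the converse of \<open>\<alpha>\<close>.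
\<close>

lemma Icf_principal_right_ideal:
  assumes \<alpha>: "\<alpha> \<in> carrier (Icf \<Lambda>)"
  shows "principal_right_ideal (Icf \<Lambda>) \<alpha> = {\<gamma> \<in> carrier (Icf \<Lambda>). dom \<gamma> \<subseteq> dom \<alpha>}"
proof (intro subset_antisym subsetI)
  fix \<gamma> assume "\<gamma> \<in> principal_right_ideal (Icf \<Lambda>) \<alpha>"
  then consider "\<gamma> = \<alpha>" | \<sigma> where "\<sigma> \<in> carrier (Icf \<Lambda>)" "\<gamma> = \<alpha> \<otimes>\<^bsub>Icf \<Lambda>\<^esub> \<sigma>"
    by (auto simp: principal_right_ideal_def)
  then show "\<gamma> \<in> {\<gamma> \<in> carrier (Icf \<Lambda>). dom \<gamma> \<subseteq> dom \<alpha>}"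
  proof cases
    case 2
    have "dom (\<sigma> \<circ>\<^sub>m \<alpha>) \<subseteq> dom \<alpha>"
      by (auto simp: map_comp_Some_iff)
    then show ?thesis
      using 2 \<alpha> Icf_mult_closed by (auto simp: Icf_mult)
  qed (use \<alpha> in simp)
next
  fix \<gamma> assume \<gamma>: "\<gamma> \<in> {\<gamma> \<in> carrier (Icf \<Lambda>). dom \<gamma> \<subseteq> dom \<alpha>}"
  have "\<gamma> = \<alpha> \<otimes>\<^bsub>Icf \<Lambda>\<^esub> (partial_inverse \<alpha> \<otimes>\<^bsub>Icf \<Lambda>\<^esub> \<gamma>)"
    using \<alpha> \<gamma> by (simp add: Icf_mult mem_Icf map_comp_partial_inverse_left)
  moreover have "partial_inverse \<alpha> \<otimes>\<^bsub>Icf \<Lambda>\<^esub> \<gamma> \<in> carrier (Icf \<Lambda>)"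
    using \<alpha> \<gamma> by (simp add: Icf_mult_closed partial_inverse_in_Icf)
  ultimately show "\<gamma> \<in> principal_right_ideal (Icf \<Lambda>) \<alpha>"
    unfolding principal_right_ideal_def by blast
qed

lemma Icf_principal_left_ideal:
  assumes \<alpha>: "\<alpha> \<in> carrier (Icf \<Lambda>)"
  shows "principal_left_ideal (Icf \<Lambda>) \<alpha> = {\<gamma> \<in> carrier (Icf \<Lambda>). ran \<gamma> \<subseteq> ran \<alpha>}"
proof (intro subset_antisym subsetI)
  fix \<gamma> assume "\<gamma> \<in> principal_left_ideal (Icf \<Lambda>) \<alpha>"
  then consider "\<gamma> = \<alpha>" | \<sigma> where "\<sigma> \<in> carrier (Icf \<Lambda>)" "\<gamma> = \<sigma> \<otimes>\<^bsub>Icf \<Lambda>\<^esub> \<alpha>"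
    by (auto simp: principal_left_ideal_def)
  then show "\<gamma> \<in> {\<gamma> \<in> carrier (Icf \<Lambda>). ran \<gamma> \<subseteq> ran \<alpha>}"
  proof cases
    case 2
    have "ran (\<alpha> \<circ>\<^sub>m \<sigma>) \<subseteq> ran \<alpha>"
      by (auto simp: ran_def map_comp_Some_iff)
    then show ?thesis
      using 2 \<alpha> Icf_mult_closed by (auto simp: Icf_mult)
  qed (use \<alpha> in simp)
next
  fix \<gamma> assume \<gamma>: "\<gamma> \<in> {\<gamma> \<in> carrier (Icf \<Lambda>). ran \<gamma> \<subseteq> ran \<alpha>}"
  have "\<gamma> = (\<gamma> \<otimes>\<^bsub>Icf \<Lambda>\<^esub> partial_inverse \<alpha>) \<otimes>\<^bsub>Icf \<Lambda>\<^esub> \<alpha>"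
    using \<alpha> \<gamma> by (simp add: Icf_mult mem_Icf map_comp_partial_inverse_right)
  moreover have "\<gamma> \<otimes>\<^bsub>Icf \<Lambda>\<^esub> partial_inverse \<alpha> \<in> carrier (Icf \<Lambda>)"
    using \<alpha> \<gamma> by (simp add: Icf_mult_closed partial_inverse_in_Icf)
  ultimately show "\<gamma> \<in> principal_left_ideal (Icf \<Lambda>) \<alpha>"
    unfolding principal_left_ideal_def by blast
qed

section \<open>Green's relations\<close>

lemma Icf_green_R_iff:
  assumes "\<alpha> \<in> carrier (Icf \<Lambda>)" "\<beta> \<in> carrier (Icf \<Lambda>)"
  shows "(\<alpha>, \<beta>) \<in> green_R (Icf \<Lambda>) \<longleftrightarrow> dom \<alpha> = dom \<beta>"
proof -
  have "{\<gamma> \<in> carrier (Icf \<Lambda>). dom \<gamma> \<subseteq> dom \<alpha>} = {\<gamma> \<in> carrier (Icf \<Lambda>). dom \<gamma> \<subseteq> dom \<beta>} \<longleftrightarrow> dom \<alpha> = dom \<beta>"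
    using assms by blast
  then show ?thesis
    using assms by (simp add: green_R_def Icf_principal_right_ideal)
qed

lemma Icf_green_L_iff:
  assumes "\<alpha> \<in> carrier (Icf \<Lambda>)" "\<beta> \<in> carrier (Icf \<Lambda>)"
  shows "(\<alpha>, \<beta>) \<in> green_L (Icf \<Lambda>) \<longleftrightarrow> ran \<alpha> = ran \<beta>"
proof -
  have "{\<gamma> \<in> carrier (Icf \<Lambda>). ran \<gamma> \<subseteq> ran \<alpha>} = {\<gamma> \<in> carrier (Icf \<Lambda>). ran \<gamma> \<subseteq> ran \<beta>} \<longleftrightarrow> ran \<alpha> = ran \<beta>"
    using assms by blast
  then show ?thesis
    using assms by (simp add: green_L_def Icf_principal_left_ideal)
qed

lemma infinite_Un_finite_eqpoll:
  assumes "finite F" and "infinite A"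
  shows "A \<union> F \<approx> A"
  using assms(1)
proof (induction F rule: finite_induct)
  case (insert x F)
  have "insert x (A \<union> F) \<approx> A \<union> F"
    using assms(2) by (intro infinite_insert_eqpoll) simp
  then show ?case
    using eqpoll_trans[OF _ insert.IH] by simp
qed simp

lemma cofinite_subsets_eqpoll:
  assumes "infinite \<Lambda>" "A \<subseteq> \<Lambda>" "B \<subseteq> \<Lambda>" "finite (\<Lambda> - A)" "finite (\<Lambda> - B)"
  shows "A \<approx> B"
proof -
  have to_whole: "\<Lambda> \<approx> A" if "A \<subseteq> \<Lambda>" "finite (\<Lambda> - A)" for A
  proof -
    have "infinite A"
      using that assms(1) by (metis Diff_infinite_finite)
    moreover have "A \<union> (\<Lambda> - A) = \<Lambda>"
      using that(1) by blast
    ultimately show ?thesis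
      using infinite_Un_finite_eqpoll[OF that(2), of A] by simp
  qed
  show ?thesis
    using to_whole[OF assms(2,4)] to_whole[OF assms(3,5)] by (meson eqpoll_sym eqpoll_trans)
qed

lemma Icf_with_dom_ran:
  assumes "infinite \<Lambda>" "A \<subseteq> \<Lambda>" "B \<subseteq> \<Lambda>" "finite (\<Lambda> - A)" "finite (\<Lambda> - B)"
  obtains \<gamma> where "\<gamma> \<in> carrier (Icf \<Lambda>)" "dom \<gamma> = A" "ran \<gamma> = B"
proof -
  obtain f where f: "bij_betw f A B"
    using cofinite_subsets_eqpoll[OF assms] by (auto simp: eqpoll_def)
  define \<gamma> where "\<gamma> = (\<lambda>x. if x \<in> A then Some (f x) else None)"
  have dom: "dom \<gamma> = A"
    by (auto simp: \<gamma>_def split: if_splits)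
  have ran: "ran \<gamma> = B"
    using f by (auto simp: \<gamma>_def ran_def bij_betw_def split: if_splits)
  have "inj_on \<gamma> (dom \<gamma>)"
    using f unfolding dom by (auto simp: \<gamma>_def inj_on_def bij_betw_def)
  then have "\<gamma> \<in> carrier (Icf \<Lambda>)"
    using assms by (simp add: mem_Icf dom ran)
  then show ?thesis
    using dom ran that by blast
qed

lemma Icf_green_D:
  assumes "infinite \<Lambda>" and \<alpha>: "\<alpha> \<in> carrier (Icf \<Lambda>)" and \<beta>: "\<beta> \<in> carrier (Icf \<Lambda>)"
  shows "(\<alpha>, \<beta>) \<in> green_D (Icf \<Lambda>)"
proof -
  obtain \<gamma> where \<gamma>: "\<gamma> \<in> carrier (Icf \<Lambda>)" "dom \<gamma> = dom \<alpha>" "ran \<gamma> = ran \<beta>"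
    using Icf_with_dom_ran[OF assms(1), of "dom \<alpha>" "ran \<beta>"] \<alpha> \<beta> by (auto simp: mem_Icf)
  then have "(\<alpha>, \<gamma>) \<in> green_R (Icf \<Lambda>)" "(\<gamma>, \<beta>) \<in> green_L (Icf \<Lambda>)"
    using \<alpha> \<beta> by (simp_all add: Icf_green_R_iff Icf_green_L_iff)
  then show ?thesis
    unfolding green_D_def by blast
qed

section \<open>Idempotents\<close>

lemma dom_restrict_Some: "dom (Some |` A) = A"
  by (auto simp: restrict_map_def split: if_splits)

lemma ran_restrict_Some: "ran (Some |` A) = A"
  by (auto simp: restrict_map_def ran_def split: if_splits)

lemma map_comp_restrict_Some: "(Some |` B) \<circ>\<^sub>m (Some |` A) = Some |` (A \<inter> B)"
  by (auto simp: restrict_map_def map_comp_def fun_eq_iff)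

lemma restrict_Some_dom_Icf_idempotent:
  assumes "\<epsilon> \<in> idempotents (Icf \<Lambda>)"
  shows "Some |` dom \<epsilon> = \<epsilon>"
proof
  fix x
  show "(Some |` dom \<epsilon>) x = \<epsilon> x"
    using Icf_idempotent_id[OF assms, of x] by (cases "\<epsilon> x") (auto simp: restrict_map_def)
qed

lemma Icf_idempotent_eqI:
  assumes "\<epsilon> \<in> idempotents (Icf \<Lambda>)" "\<iota> \<in> idempotents (Icf \<Lambda>)" "dom \<epsilon> = dom \<iota>"
  shows "\<epsilon> = \<iota>"
  using assms restrict_Some_dom_Icf_idempotent by metis

lemma restrict_Some_idempotent:
  assumes "A \<subseteq> \<Lambda>" "finite (\<Lambda> - A)"
  shows "Some |` A \<in> idempotents (Icf \<Lambda>)"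
proof -
  have "inj_on (Some |` A) A"
    by (auto simp: inj_on_def)
  then show ?thesis
    using assms
    by (simp add: idempotents_def mem_Icf Icf_mult dom_restrict_Some ran_restrict_Some
        map_comp_restrict_Some)
qed

lemma Icf_idempotent_iff:
  assumes "\<alpha> \<in> carrier (Icf \<Lambda>)"
  shows "\<alpha> \<in> idempotents (Icf \<Lambda>) \<longleftrightarrow> (\<forall>x \<in> dom \<alpha>. \<alpha> x = Some x)"
proof
  assume "\<alpha> \<in> idempotents (Icf \<Lambda>)"
  then show "\<forall>x \<in> dom \<alpha>. \<alpha> x = Some x"
    by (metis Icf_idempotent_id domD)
next
  assume id: "\<forall>x \<in> dom \<alpha>. \<alpha> x = Some x"
  have "(Some |` dom \<alpha>) x = \<alpha> x" for x
  proof (cases "x \<in> dom \<alpha>")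
    case True
    then show ?thesis
      using bspec[OF id True] by simp
  qed (simp add: domIff)
  then have "Some |` dom \<alpha> = \<alpha>"
    by blast
  moreover have "Some |` dom \<alpha> \<in> idempotents (Icf \<Lambda>)"
    using assms by (intro restrict_Some_idempotent) (simp_all add: mem_Icf)
  ultimately show "\<alpha> \<in> idempotents (Icf \<Lambda>)"
    by simp
qed

lemma Icf_idempotent_mult:
  assumes "\<epsilon> \<in> idempotents (Icf \<Lambda>)" "\<iota> \<in> idempotents (Icf \<Lambda>)"
  shows "\<epsilon> \<otimes>\<^bsub>Icf \<Lambda>\<^esub> \<iota> = Some |` (dom \<epsilon> \<inter> dom \<iota>)"
  using assms restrict_Some_dom_Icf_idempotent[of \<epsilon> \<Lambda>] restrict_Some_dom_Icf_idempotent[of \<iota> \<Lambda>]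
  by (metis Icf_mult map_comp_restrict_Some)

lemma dom_Icf_idempotent_mult:
  assumes "\<epsilon> \<in> idempotents (Icf \<Lambda>)" "\<iota> \<in> idempotents (Icf \<Lambda>)"
  shows "dom (\<epsilon> \<otimes>\<^bsub>Icf \<Lambda>\<^esub> \<iota>) = dom \<epsilon> \<inter> dom \<iota>"
  by (simp only: Icf_idempotent_mult[OF assms] dom_restrict_Some)

lemma Icf_natural_le_iff:
  assumes "\<epsilon> \<in> idempotents (Icf \<Lambda>)" "\<iota> \<in> idempotents (Icf \<Lambda>)"
  shows "natural_le (Icf \<Lambda>) \<epsilon> \<iota> \<longleftrightarrow> dom \<epsilon> \<subseteq> dom \<iota>"
proof
  assume "natural_le (Icf \<Lambda>) \<epsilon> \<iota>"
  then have "dom (\<epsilon> \<otimes>\<^bsub>Icf \<Lambda>\<^esub> \<iota>) = dom \<epsilon>"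
    by (simp add: natural_le_def)
  then show "dom \<epsilon> \<subseteq> dom \<iota>"
    using assms by (auto simp: dom_Icf_idempotent_mult)
next
  assume "dom \<epsilon> \<subseteq> dom \<iota>"
  then have "dom \<epsilon> \<inter> dom \<iota> = dom \<epsilon>" "dom \<iota> \<inter> dom \<epsilon> = dom \<epsilon>"
    by blast+
  then show "natural_le (Icf \<Lambda>) \<epsilon> \<iota>"
    using assms restrict_Some_dom_Icf_idempotent[of \<epsilon> \<Lambda>]
    by (simp add: natural_le_def Icf_idempotent_mult)
qed

lemma Icf_idempotent_complement:
  assumes "\<epsilon> \<in> idempotents (Icf \<Lambda>)"
  shows "dom \<epsilon> \<subseteq> \<Lambda>" "finite (\<Lambda> - dom \<epsilon>)"
  using assms by (auto simp: idempotents_def mem_Icf)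

lemma bij_betw_Icf_idempotents_finite_subsets:
  "bij_betw (\<lambda>\<epsilon>. \<Lambda> - dom \<epsilon>) (idempotents (Icf \<Lambda>)) {A. A \<subseteq> \<Lambda> \<and> finite A}"
proof (rule bij_betwI')
  fix \<epsilon> \<iota> assume *: "\<epsilon> \<in> idempotents (Icf \<Lambda>)" "\<iota> \<in> idempotents (Icf \<Lambda>)"
  have "dom \<epsilon> = dom \<iota>" if "\<Lambda> - dom \<epsilon> = \<Lambda> - dom \<iota>"
    using that Icf_idempotent_complement(1)[OF *(1)] Icf_idempotent_complement(1)[OF *(2)] by blast
  then show "(\<Lambda> - dom \<epsilon> = \<Lambda> - dom \<iota>) = (\<epsilon> = \<iota>)"
    using Icf_idempotent_eqI[OF *] by blast
next
  fix \<epsilon> assume "\<epsilon> \<in> idempotents (Icf \<Lambda>)"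
  then show "\<Lambda> - dom \<epsilon> \<in> {A. A \<subseteq> \<Lambda> \<and> finite A}"
    by (auto dest: Icf_idempotent_complement(2))
next
  fix A assume "A \<in> {A. A \<subseteq> \<Lambda> \<and> finite A}"
  then have A: "\<Lambda> - (\<Lambda> - A) = A" "finite A"
    by auto
  then have "Some |` (\<Lambda> - A) \<in> idempotents (Icf \<Lambda>)"
    by (intro restrict_Some_idempotent) auto
  moreover have "A = \<Lambda> - dom (Some |` (\<Lambda> - A))"
    using A by (simp add: dom_restrict_Some)
  ultimately show "\<exists>\<epsilon> \<in> idempotents (Icf \<Lambda>). A = \<Lambda> - dom \<epsilon>"
    by blast
qed

lemma Icf_idempotents_iso_Pfin:
  "(\<lambda>\<epsilon>. \<Lambda> - dom \<epsilon>) \<in> iso (idempotent_semilattice (Icf \<Lambda>)) (Pfin \<Lambda>)"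
  using bij_betw_Icf_idempotents_finite_subsets[of \<Lambda>]
  by (auto simp: iso_def hom_def idempotent_semilattice_def Pfin_def dom_Icf_idempotent_mult
      Icf_idempotent_complement)

section \<open>Maximal chains\<close>

text \<open>
  Along a chain of finite sets, cardinality determines the set, so only surjectivity needs maximality,
  and it goes by induction. Given a member \<open>F\<close> of cardinality \<open>n\<close>, pick \<open>x\<close> outside \<open>F\<close> that lies in
  every larger member: from the smallest larger member if there is one, and anywhere in the infinite
  set otherwise. Then \<open>insert x F\<close> is comparable with the whole chain.
\<close>

lemma bij_betw_card_maximal_finite_chain:
  assumes inf: "infinite \<Lambda>"
    and fin: "\<And>F. F \<in> \<C> \<Longrightarrow> F \<subseteq> \<Lambda> \<and> finite F"
    and chain: "\<And>F G. F \<in> \<C> \<Longrightarrow> G \<in> \<C> \<Longrightarrow> F \<subseteq> G \<or> G \<subseteq> F"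
    and maximal: "\<And>F. F \<subseteq> \<Lambda> \<Longrightarrow> finite F \<Longrightarrow> (\<And>G. G \<in> \<C> \<Longrightarrow> F \<subseteq> G \<or> G \<subseteq> F) \<Longrightarrow> F \<in> \<C>"
  shows "bij_betw card \<C> UNIV"
proof -
  have card_le: "F \<subseteq> G" if "F \<in> \<C>" "G \<in> \<C>" "card F \<le> card G" for F G
    using chain[OF that(1,2)] fin[OF that(1)] that(3) card_seteq by blast
  have inj: "inj_on card \<C>"
    by (rule inj_onI) (simp add: card_le subset_antisym)
  have "\<exists>F \<in> \<C>. card F = n" for n
  proof (induction n)
    case 0
    have "{} \<in> \<C>"
      by (rule maximal) auto
    then show ?case
      by force
  next
    case (Suc n)
    then obtain F where F: "F \<in> \<C>" "card F = n"
      by blast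
    obtain x where x: "x \<in> \<Lambda> - F" "\<And>G. G \<in> \<C> \<Longrightarrow> n < card G \<Longrightarrow> x \<in> G"
    proof (cases "\<exists>G \<in> \<C>. n < card G")
      case True
      then obtain G where G: "G \<in> \<C>" "n < card G"
        and least: "\<And>H. H \<in> \<C> \<Longrightarrow> n < card H \<Longrightarrow> card G \<le> card H"
        using ex_has_least_nat[of "\<lambda>G. G \<in> \<C> \<and> n < card G" _ card] by blast
      have "\<not> G \<subseteq> F"
        using G(2) F fin[OF F(1)] card_mono by (metis not_le)
      then obtain x where "x \<in> G" "x \<notin> F"
        by blast
      then show ?thesis
        using that[of x] fin[OF G(1)] least card_le[OF G(1)] by blast
    next
      case False
      obtain x where "x \<in> \<Lambda> - F"
        using inf fin[OF F(1)] by (metis Diff_infinite_finite ex_in_conv finite.emptyI)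
      then show ?thesis
        using that False by blast
    qed
    have "insert x F \<in> \<C>"
    proof (rule maximal)
      fix G assume G: "G \<in> \<C>"
      show "insert x F \<subseteq> G \<or> G \<subseteq> insert x F"
      proof (cases "n < card G")
        case True
        then show ?thesis
          using x(2)[OF G] card_le[OF F(1) G] F(2) by auto
      next
        case False
        then show ?thesis
          using card_le[OF G F(1)] F(2) by auto
      qed
    qed (use x(1) fin[OF F(1)] in auto)
    moreover have "card (insert x F) = Suc n"
      using x(1) F fin[OF F(1)] by simp
    ultimately show ?case
      by blast
  qed
  then have "card ` \<C> = UNIV"
    by (auto simp: image_iff) metis
  with inj show ?thesis
    by (simp add: bij_betw_def)
qed

lemma bij_betw_uminus_int: "bij_betw (\<lambda>n. - int n) UNIV {..0}"
  by (rule bij_betwI[where g = "\<lambda>k. nat (- k)"]) auto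

lemma Icf_maximal_idempotent_chain_omega_chain:
  assumes inf: "infinite \<Lambda>" and max: "maximal_idempotent_chain (Icf \<Lambda>) C"
  shows "omega_chain (natural_le (Icf \<Lambda>)) C"
proof -
  let ?E = "idempotents (Icf \<Lambda>)" and ?h = "\<lambda>\<epsilon>. \<Lambda> - dom \<epsilon>"
  have le_iff: "natural_le (Icf \<Lambda>) \<epsilon> \<iota> \<longleftrightarrow> ?h \<iota> \<subseteq> ?h \<epsilon>" if "\<epsilon> \<in> ?E" "\<iota> \<in> ?E" for \<epsilon> \<iota>
    using that Icf_natural_le_iff[OF that] Icf_idempotent_complement(1)[of \<epsilon> \<Lambda>] by blast
  have C: "C \<subseteq> ?E"
    using max by (simp add: maximal_idempotent_chain_def pred_on.maxchain_def pred_on.chain_def)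
  have comparable: "\<And>\<epsilon> \<iota>. \<epsilon> \<in> C \<Longrightarrow> \<iota> \<in> C \<Longrightarrow> ?h \<epsilon> \<subseteq> ?h \<iota> \<or> ?h \<iota> \<subseteq> ?h \<epsilon>"
  proof -
    fix \<epsilon> \<iota> assume *: "\<epsilon> \<in> C" "\<iota> \<in> C"
    then have "natural_le (Icf \<Lambda>) \<epsilon> \<iota> \<or> natural_le (Icf \<Lambda>) \<iota> \<epsilon> \<or> \<epsilon> = \<iota>"
      using max
      unfolding maximal_idempotent_chain_def pred_on.maxchain_def pred_on.chain_def by blast
    then show "?h \<epsilon> \<subseteq> ?h \<iota> \<or> ?h \<iota> \<subseteq> ?h \<epsilon>"
      using le_iff * C by (metis subset_iff)
  qed
  have unextendable: "D = C" if "pred_on.chain ?E (natural_le (Icf \<Lambda>)) D" "C \<subseteq> D" for D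
    using max that unfolding maximal_idempotent_chain_def pred_on.maxchain_def by blast
  have maximal: "\<epsilon> \<in> C" if \<epsilon>: "\<epsilon> \<in> ?E" and comp_\<epsilon>: "\<And>\<iota>. \<iota> \<in> C \<Longrightarrow> ?h \<epsilon> \<subseteq> ?h \<iota> \<or> ?h \<iota> \<subseteq> ?h \<epsilon>" for \<epsilon>
  proof -
    have "natural_le (Icf \<Lambda>) \<iota> \<kappa> \<or> natural_le (Icf \<Lambda>) \<kappa> \<iota>"
      if "\<iota> \<in> insert \<epsilon> C" "\<kappa> \<in> insert \<epsilon> C" for \<iota> \<kappa>
    proof -
      have "?h \<iota> \<subseteq> ?h \<kappa> \<or> ?h \<kappa> \<subseteq> ?h \<iota>"
        using that comparable comp_\<epsilon> by (metis insert_iff order_refl)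
      then show ?thesis
        using le_iff that C \<epsilon> by (metis insert_iff subsetD)
    qed
    then have "pred_on.chain ?E (natural_le (Icf \<Lambda>)) (insert \<epsilon> C)"
      using C \<epsilon> unfolding pred_on.chain_def by blast
    then show ?thesis
      using unextendable by blast
  qed
  have inj: "inj_on ?h ?E"
    using bij_betw_Icf_idempotents_finite_subsets by (rule bij_betw_imp_inj_on)
  have card: "bij_betw card (?h ` C) UNIV"
  proof (rule bij_betw_card_maximal_finite_chain[OF inf])
    fix F assume F: "F \<subseteq> \<Lambda>" "finite F" "\<And>G. G \<in> ?h ` C \<Longrightarrow> F \<subseteq> G \<or> G \<subseteq> F"
    have "F \<in> ?h ` ?E"
      using F(1,2) bij_betw_imp_surj_on[OF bij_betw_Icf_idempotents_finite_subsets[of \<Lambda>]] by simp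
    then obtain \<epsilon> where \<epsilon>: "\<epsilon> \<in> ?E" "F = ?h \<epsilon>"
      by blast
    have "\<epsilon> \<in> C"
      using \<epsilon> F(3) by (intro maximal) auto
    then show "F \<in> ?h ` C"
      using \<epsilon>(2) by blast
  next
    fix F assume "F \<in> ?h ` C"
    then show "F \<subseteq> \<Lambda> \<and> finite F"
      using C Icf_idempotent_complement(2) by blast
  next
    fix F G assume "F \<in> ?h ` C" "G \<in> ?h ` C"
    then obtain \<epsilon> \<iota> where "\<epsilon> \<in> C" "F = ?h \<epsilon>" "\<iota> \<in> C" "G = ?h \<iota>"
      by blast
    then show "F \<subseteq> G \<or> G \<subseteq> F"
      using comparable[of \<epsilon> \<iota>] by simp
  qed
  let ?\<phi> = "\<lambda>\<epsilon>. - int (card (?h \<epsilon>))"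
  have "bij_betw ?h C (?h ` C)"
    using inj C by (simp add: inj_on_subset inj_on_imp_bij_betw)
  then have "bij_betw ?\<phi> C {..0}"
    using bij_betw_trans[OF bij_betw_trans[OF _ card] bij_betw_uminus_int] by (simp add: comp_def)
  moreover have "natural_le (Icf \<Lambda>) \<epsilon> \<iota> \<longleftrightarrow> ?\<phi> \<epsilon> \<le> ?\<phi> \<iota>" if "\<epsilon> \<in> C" "\<iota> \<in> C" for \<epsilon> \<iota>
  proof -
    have fin: "finite (?h \<epsilon>)" "finite (?h \<iota>)"
      using that C Icf_idempotent_complement(2) by blast+
    have "?h \<iota> \<subseteq> ?h \<epsilon> \<longleftrightarrow> card (?h \<iota>) \<le> card (?h \<epsilon>)"
      using comparable[OF that] card_mono[OF fin(1)] card_seteq[OF fin(2), of "?h \<epsilon>"] by blast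
    moreover have "natural_le (Icf \<Lambda>) \<epsilon> \<iota> \<longleftrightarrow> ?h \<iota> \<subseteq> ?h \<epsilon>"
      using le_iff that C by blast
    ultimately show ?thesis
      by simp
  qed
  ultimately show ?thesis
    unfolding omega_chain_def by blast
qed

section \<open>The structure of the monoid of injective partial cofinite selfmaps\<close>

theorem proposition2p1:
  fixes \<Lambda> :: "'a set"
  assumes "infinite \<Lambda>"
  shows
    "simple_semigroup (Icf \<Lambda>)
   \<and> (\<forall>\<alpha> \<in> carrier (Icf \<Lambda>).
        \<alpha> \<in> idempotents (Icf \<Lambda>) \<longleftrightarrow> (\<forall>x \<in> dom \<alpha>. \<alpha> x = Some x))
   \<and> (\<forall>\<epsilon> \<in> idempotents (Icf \<Lambda>). \<forall>\<iota> \<in> idempotents (Icf \<Lambda>).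
        natural_le (Icf \<Lambda>) \<epsilon> \<iota> \<longleftrightarrow> dom \<epsilon> \<subseteq> dom \<iota>)
   \<and> (\<lambda>\<epsilon>. \<Lambda> - dom \<epsilon>) \<in> iso (idempotent_semilattice (Icf \<Lambda>)) (Pfin \<Lambda>)
   \<and> (\<forall>C. maximal_idempotent_chain (Icf \<Lambda>) C \<longrightarrow> omega_chain (natural_le (Icf \<Lambda>)) C)
   \<and> (\<forall>\<alpha> \<in> carrier (Icf \<Lambda>). \<forall>\<beta> \<in> carrier (Icf \<Lambda>).
        (\<alpha>, \<beta>) \<in> green_R (Icf \<Lambda>) \<longleftrightarrow> dom \<alpha> = dom \<beta>)
   \<and> (\<forall>\<alpha> \<in> carrier (Icf \<Lambda>). \<forall>\<beta> \<in> carrier (Icf \<Lambda>).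
        (\<alpha>, \<beta>) \<in> green_L (Icf \<Lambda>) \<longleftrightarrow> ran \<alpha> = ran \<beta>)
   \<and> (\<forall>\<alpha> \<in> carrier (Icf \<Lambda>). \<forall>\<beta> \<in> carrier (Icf \<Lambda>).
        (\<alpha>, \<beta>) \<in> green_H (Icf \<Lambda>) \<longleftrightarrow> dom \<alpha> = dom \<beta> \<and> ran \<alpha> = ran \<beta>)
   \<and> (\<forall>\<alpha> \<in> carrier (Icf \<Lambda>). \<forall>\<beta> \<in> carrier (Icf \<Lambda>). (\<alpha>, \<beta>) \<in> green_D (Icf \<Lambda>))
   \<and> bisimple_semigroup (Icf \<Lambda>)"
proof -
  have D: "\<And>\<alpha> \<beta>. \<alpha> \<in> carrier (Icf \<Lambda>) \<Longrightarrow> \<beta> \<in> carrier (Icf \<Lambda>) \<Longrightarrow> (\<alpha>, \<beta>) \<in> green_D (Icf \<Lambda>)"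
    using Icf_green_D[OF assms] .
  have nonempty: "carrier (Icf \<Lambda>) \<noteq> {}"
    using monoid.one_closed[OF Icf_monoid] by blast
  show ?thesis
    using D simple_semigroup_if_one_D_class[OF D] bisimple_semigroup_if_one_D_class[OF nonempty D]
      Icf_idempotents_iso_Pfin Icf_maximal_idempotent_chain_omega_chain[OF assms]
    by (simp add: Icf_idempotent_iff Icf_natural_le_iff Icf_green_R_iff Icf_green_L_iff green_H_def)
qed

end
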